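(* Let $\mathcal{M}$ be a $\mathbb{Z}$-irreducible multiset of subsets of $[N]$ with complexity $m$. Then $m\le(N+1)^{(N+1)/2}$.
   Context: A multiset $\mathcal{M}$ of subsets of $[N]$ is balanced with complexity $m$ if each $i\in[N]$ belongs to exactly $m$ members of $\mathcal{M}$ (counted with multiplicity). A balanced multiset is $\mathbb{Z}$-irreducible if no proper nonempty sub-multiset of it is balanced. *)

theory Defs
  imports Complex_Main "HOL-Library.Multiset"
begin

definition balanced_with_complexity :: "nat \<Rightarrow> nat set multiset \<Rightarrow> nat \<Rightarrow> bool" where
  "balanced_with_complexity N M m \<longleftrightarrow>
     (\<forall>S \<in># M. S \<subseteq> {1..N}) \<and> (\<forall>i \<in> {1..N}. size {#S \<in># M. i \<in> S#} = m)"

definition balanced :: "nat \<Rightarrow> nat set multiset \<Rightarrow> bool" where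
  "balanced N M \<longleftrightarrow> (\<exists>m. balanced_with_complexity N M m)"

text \<open>A proper nonempty sub-multiset is balanced with respect to a complexity of its own, which
  need not be the complexity of the whole multiset.\<close>

definition Z_irreducible :: "nat \<Rightarrow> nat set multiset \<Rightarrow> bool" where
  "Z_irreducible N M \<longleftrightarrow>
     balanced N M \<and> \<not> (\<exists>M'. M' \<subset># M \<and> M' \<noteq> {#} \<and> balanced N M')"

end

theory Submission
  imports Defs "Jordan_Normal_Form.Determinant"
begin

text \<open>The multiplicity function of a balanced multiset is peeled, in the manner of Caratheodory,
  into at most \<open>2^N\<close> balanced weights of linearly independent support.  By Cramer's rule such a
  weight is a multiple of an integral one whose complexity is the determinant of an
  \<open>N \<times> N\<close> 0/1 matrix, hence at most \<open>(N+1)^((N+1)/2) / 2^N\<close> by Hadamard's inequality.  If the multiset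
  is irreducible, either it equals one of these integral weights, or all of them occur with
  coefficient below 1, so that the complexity is at most \<open>2^N\<close> times this determinant bound.\<close>

section \<open>Hadamard's inequality\<close>

text \<open>One Gram-Schmidt step: row \<open>k\<close> loses its projection onto row
  \<open>i\<close>. This is a row operation, so the determinant stays, and removing a projection
  lengthens nothing. The last conclusion preserves orthogonality to rows treated earlier.\<close>

lemma addrow_orthogonalize:
  fixes B :: "real mat"
  assumes B: "B \<in> carrier_mat n n" and k: "k < n" and i: "i < n" "i \<noteq> k"
  obtains C where "C \<in> carrier_mat n n" "det C = det B"
    "\<And>r. r < n \<Longrightarrow> r \<noteq> k \<Longrightarrow> row C r = row B r"
    "row C k \<bullet> row B i = 0"
    "row C k \<bullet> row C k \<le> row B k \<bullet> row B k"
    "\<And>s. s < n \<Longrightarrow> row B i \<bullet> row B s = 0 \<Longrightarrow> row C k \<bullet> row B s = row B k \<bullet> row B s"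
proof -
  define u where "u = row B i"
  define v where "v = row B k"
  have u: "u \<in> carrier_vec n" and v: "v \<in> carrier_vec n" using B unfolding u_def v_def by auto
  define a where "a = - (v \<bullet> u) / (u \<bullet> u)"
  define C where "C = addrow a k i B"
  have rk: "row C k = a \<cdot>\<^sub>v u + v"
    using B k i unfolding C_def u_def v_def by (auto intro!: eq_vecI)
  have ro: "row C r = row B r" if "r < n" "r \<noteq> k" for r
    using B that k i unfolding C_def by (auto intro!: eq_vecI)
  have dist: "(a \<cdot>\<^sub>v u + v) \<bullet> w = a * (u \<bullet> w) + v \<bullet> w" if "w \<in> carrier_vec n" for w
    using that u v by (simp add: add_scalar_prod_distrib[of _ n] smult_scalar_prod_distrib[of _ n])
  \<comment> \<open>If \<open>u\<close> has length 0, division by zero makes \<open>a = 0\<close>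
    and leaves the row unchanged; it must then be orthogonal to \<open>u\<close> already.\<close>
  have u0: "v \<bullet> u = 0" if "u \<bullet> u = 0"
  proof -
    have "u $ j = 0" if "j < n" for j
    proof -
      have "(\<Sum>j = 0..<n. u $ j * u $ j) = 0" using \<open>u \<bullet> u = 0\<close> u by (simp add: scalar_prod_def)
      then show ?thesis using that by (subst (asm) sum_nonneg_eq_0_iff) auto
    qed
    then show ?thesis using u v by (simp add: scalar_prod_def)
  qed
  have orth: "a * (u \<bullet> u) + v \<bullet> u = 0" using u0 unfolding a_def by (cases "u \<bullet> u = 0") auto
  have uv: "u \<bullet> v = v \<bullet> u" using u v by (rule comm_scalar_prod)
  have uu: "u \<bullet> u \<ge> 0" unfolding scalar_prod_def by (rule sum_nonneg) auto
  have "(a \<cdot>\<^sub>v u + v) \<bullet> (a \<cdot>\<^sub>v u + v) = v \<bullet> v + a * (v \<bullet> u)"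
  proof -
    have "(a \<cdot>\<^sub>v u + v) \<bullet> (a \<cdot>\<^sub>v u + v) = a * (u \<bullet> (a \<cdot>\<^sub>v u + v)) + v \<bullet> (a \<cdot>\<^sub>v u + v)"
      using u v by (intro dist) auto
    also have "u \<bullet> (a \<cdot>\<^sub>v u + v) = a * (u \<bullet> u) + v \<bullet> u"
      using u v uv by (simp add: scalar_prod_add_distrib[of _ n])
    also have "v \<bullet> (a \<cdot>\<^sub>v u + v) = a * (v \<bullet> u) + v \<bullet> v"
      using u v by (simp add: scalar_prod_add_distrib[of _ n])
    finally show ?thesis using orth by simp
  qed
  moreover have "a * (v \<bullet> u) \<le> 0"
    unfolding a_def using uu by (simp add: divide_nonneg_nonneg)
  ultimately have "row C k \<bullet> row C k \<le> row B k \<bullet> row B k" unfolding rk v_def by simp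
  moreover have "row C k \<bullet> row B i = 0" using dist[OF u] orth rk unfolding u_def by simp
  moreover have "row C k \<bullet> row B s = row B k \<bullet> row B s" if "s < n" "row B i \<bullet> row B s = 0" for s
    using dist[of "row B s"] B that unfolding rk u_def v_def by auto
  moreover have "det C = det B" unfolding C_def using B i k by (intro det_addrow) auto
  moreover have "C \<in> carrier_mat n n" using B unfolding C_def by simp
  ultimately show ?thesis using that ro by blast
qed

text \<open>Gram-Schmidt without normalisation: each row in turn is cleared against its
  predecessors, by two nested inductions.\<close>

lemma orthogonal_rows_exist:
  fixes A :: "real mat"
  assumes A: "A \<in> carrier_mat n n"
  obtains B where "B \<in> carrier_mat n n" "det B = det A"
    "\<And>r. r < n \<Longrightarrow> row B r \<bullet> row B r \<le> row A r \<bullet> row A r"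
    "\<And>r s. r < n \<Longrightarrow> s < n \<Longrightarrow> r \<noteq> s \<Longrightarrow> row B r \<bullet> row B s = 0"
proof -
  \<comment> \<open>State of the process: the first \<open>k\<close> rows are pairwise orthogonal,
    and row \<open>k\<close> is already cleared against the first \<open>i\<close> rows. The last
    clause is vacuous for \<open>i = 0\<close>, so the final state \<open>P B n 0\<close> does not
    refer to a row \<open>n\<close>.\<close>
  define P where "P = (\<lambda>B k i. B \<in> carrier_mat n n \<and> det B = det A
    \<and> (\<forall>r<n. row B r \<bullet> row B r \<le> row A r \<bullet> row A r)
    \<and> (\<forall>r<k. \<forall>s<k. r \<noteq> s \<longrightarrow> row B r \<bullet> row B s = 0)
    \<and> (\<forall>s<i. row B k \<bullet> row B s = 0))"
  have inner: "\<exists>B. P B k i" if "\<exists>B. P B k 0" "k < n" "i \<le> k" for k i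
    using \<open>i \<le> k\<close>
  proof (induction i)
    case 0
    then show ?case using that by simp
  next
    case (Suc i)
    then obtain B where B: "P B k i" by auto
    have i: "i < k" "i < n" "i \<noteq> k" using Suc.prems \<open>k < n\<close> by auto
    obtain C where C: "C \<in> carrier_mat n n" "det C = det B"
      "\<And>r. r < n \<Longrightarrow> r \<noteq> k \<Longrightarrow> row C r = row B r"
      "row C k \<bullet> row B i = 0"
      "row C k \<bullet> row C k \<le> row B k \<bullet> row B k"
      "\<And>s. s < n \<Longrightarrow> row B i \<bullet> row B s = 0 \<Longrightarrow> row C k \<bullet> row B s = row B k \<bullet> row B s"
      using addrow_orthogonalize[of B n k i] B \<open>k < n\<close> i unfolding P_def by metis
    have "row C r \<bullet> row C r \<le> row A r \<bullet> row A r" if "r < n" for r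
      using B C(3,5) that unfolding P_def by (cases "r = k") (auto intro: order_trans)
    moreover have "row C r \<bullet> row C s = 0" if "r < k" "s < k" "r \<noteq> s" for r s
      using B C(3) that \<open>k < n\<close> unfolding P_def by auto
    moreover have "row C k \<bullet> row C s = 0" if "s < Suc i" for s
    proof (cases "s = i")
      case True
      then show ?thesis using C(3)[of i] C(4) i by simp
    next
      case False
      \<comment> \<open>Rows \<open>i\<close> and \<open>s\<close> both precede row
        \<open>k\<close>, hence are orthogonal, so clearing against row \<open>i\<close> does not
        spoil what was achieved for row \<open>s\<close>.\<close>
      then have s: "s < i" "s < n" "s \<noteq> k" "s < k" using that i by auto
      then have "row B i \<bullet> row B s = 0" "row B k \<bullet> row B s = 0"
        using B i unfolding P_def by auto
      then show ?thesis using C(3)[of s] C(6)[of s] s by simp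
    qed
    ultimately have "P C k (Suc i)" using B C(1,2) unfolding P_def by auto
    then show ?case by blast
  qed
  have outer: "\<exists>B. P B k 0" if "k \<le> n" for k
    using that
  proof (induction k)
    case 0
    show ?case using A unfolding P_def by (intro exI[of _ A]) auto
  next
    case (Suc k)
    then obtain B where B: "P B k k" using inner[of k k] by auto
    have "row B r \<bullet> row B s = 0" if "r < Suc k" "s < Suc k" "r \<noteq> s" for r s
    proof -
      have "row B r \<bullet> row B s = row B s \<bullet> row B r"
        using B Suc.prems unfolding P_def by (intro comm_scalar_prod[of _ n]) auto
      then show ?thesis using B that unfolding P_def by (auto simp: less_Suc_eq)
    qed
    then have "P B (Suc k) 0" using B unfolding P_def by auto
    then show ?case by blast
  qed
  obtain B where "P B n 0" using outer[of n] by auto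
  then show ?thesis using that unfolding P_def by auto
qed

text \<open>For orthogonal rows the Gram matrix is diagonal and equality holds; orthogonalisation
  keeps the determinant and lengthens no row.\<close>

lemma Hadamard_inequality:
  fixes A :: "real mat"
  assumes A: "A \<in> carrier_mat n n"
  shows "(det A)\<^sup>2 \<le> (\<Prod>r = 0..<n. row A r \<bullet> row A r)"
proof -
  obtain B where B: "B \<in> carrier_mat n n" "det B = det A"
    and le: "\<And>r. r < n \<Longrightarrow> row B r \<bullet> row B r \<le> row A r \<bullet> row A r"
    and orth: "\<And>r s. r < n \<Longrightarrow> s < n \<Longrightarrow> r \<noteq> s \<Longrightarrow> row B r \<bullet> row B s = 0"
    using orthogonal_rows_exist[OF A] by metis
  have C: "B * transpose_mat B \<in> carrier_mat n n" using B(1) by auto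
  have "(det A)\<^sup>2 = det (B * transpose_mat B)"
    using det_mult[OF B(1), of "transpose_mat B"] det_transpose[OF B(1)] B
    by (simp add: power2_eq_square)
  also have "\<dots> = prod_list (diag_mat (B * transpose_mat B))"
    by (rule det_lower_triangular[OF _ C]) (use B(1) orth in auto)
  also have "\<dots> = (\<Prod>r = 0..<n. row B r \<bullet> row B r)"
    unfolding prod_list_diag_prod using B(1) by (auto intro!: prod.cong)
  also have "\<dots> \<le> (\<Prod>r = 0..<n. row A r \<bullet> row A r)"
    using le by (intro prod_mono) (auto simp: scalar_prod_def intro!: sum_nonneg)
  finally show ?thesis .
qed

text \<open>Adding the first row of the bordered \<open>\<plusminus>1\<close> matrix \<open>C\<close> to all other rows turns it into the block
  matrix \<open>D\<close> with diagonal blocks \<open>1\<close> and \<open>2A\<close>.\<close>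

lemma det_zero_one_matrix_le:
  fixes A :: "real mat"
  assumes A: "A \<in> carrier_mat n n"
    and zo: "\<And>i j. i < n \<Longrightarrow> j < n \<Longrightarrow> A $$ (i, j) \<in> {0, 1}"
  shows "2 ^ n * \<bar>det A\<bar> \<le> (real n + 1) powr ((real n + 1) / 2)"
proof -
  define J where "J = (mat 1 n (\<lambda>_. 1) :: real mat)"
  define D where "D = four_block_mat (1\<^sub>m 1) J (0\<^sub>m n 1) (2 \<cdot>\<^sub>m A)"
  \<comment> \<open>\<open>L\<close> subtracts the first row from every other row, so the lower
    right block of \<open>C\<close> is \<open>2A\<close> minus the all-ones matrix.\<close>
  define L where "L = four_block_mat (1\<^sub>m 1) (0\<^sub>m 1 n) (mat n 1 (\<lambda>_. - 1)) (1\<^sub>m n :: real mat)"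
  define C where "C = L * D"
  have J: "J \<in> carrier_mat 1 n" unfolding J_def by simp
  have D: "D \<in> carrier_mat (Suc n) (Suc n)"
    using A four_block_carrier_mat[of "1\<^sub>m 1" 1 1 "2 \<cdot>\<^sub>m A" n n] unfolding D_def by simp
  have L: "L \<in> carrier_mat (Suc n) (Suc n)"
    using four_block_carrier_mat[of "1\<^sub>m 1" 1 1 "1\<^sub>m n" n n] unfolding L_def by simp
  have C: "C \<in> carrier_mat (Suc n) (Suc n)" using L D unfolding C_def by simp
  have "det D = 2 ^ n * det A"
    unfolding D_def
    by (subst det_four_block_mat_lower_left_zero_col[OF _ J refl]) (use A in auto)
  moreover have "det L = 1"
    unfolding L_def
    by (subst det_four_block_mat_upper_right_zero[OF _ refl]) auto
  ultimately have detC: "det C = 2 ^ n * det A"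
    unfolding C_def using det_mult[OF L D] by simp
  have C_eq: "C = four_block_mat (1\<^sub>m 1) J (mat n 1 (\<lambda>_. - 1)) (mat n 1 (\<lambda>_. - 1) * J + 2 \<cdot>\<^sub>m A)"
    unfolding C_def L_def D_def
    by (subst mult_four_block_mat[where ?nr1.0 = 1 and ?n1.0 = 1 and ?n2.0 = n and ?nr2.0 = n
          and ?nc1.0 = 1 and ?nc2.0 = n])
       (use A J in \<open>auto intro!: arg_cong2[where f = "\<lambda>X Y. four_block_mat _ _ X Y"] eq_matI\<close>)
  have pm: "C $$ (i, j) * C $$ (i, j) = 1" if "i < Suc n" "j < Suc n" for i j
  proof -
    \<comment> \<open>Border entries of \<open>C\<close> are 1 or -1 outright; an inner entry is
      \<open>2 * a - 1\<close> with \<open>a\<close> in \<open>{0, 1}\<close>.\<close>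
    have "j = 0 \<or> i = 0 \<or> A $$ (i - 1, j - 1) \<in> {0, 1}"
      using zo[of "i - 1" "j - 1"] that by (cases i; cases j) auto
    then show ?thesis
      unfolding C_eq using that A J by (auto simp: J_def scalar_prod_def)
  qed
  have "(2 ^ n * \<bar>det A\<bar>)\<^sup>2 = (det C)\<^sup>2" unfolding detC by (simp add: power_mult_distrib)
  also have "\<dots> \<le> (\<Prod>r = 0..<Suc n. row C r \<bullet> row C r)" by (rule Hadamard_inequality[OF C])
  also have "\<dots> = (\<Prod>r = 0..<Suc n. real (Suc n))"
    by (rule prod.cong) (use C pm in \<open>auto simp: scalar_prod_def\<close>)
  also have "\<dots> = (real n + 1) ^ Suc n" by (simp add: add.commute)
  also have "\<dots> = (real n + 1) powr (real n + 1)"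
    using powr_realpow[of "real n + 1" "Suc n"] by (simp add: add.commute)
  also have "\<dots> = ((real n + 1) powr ((real n + 1) / 2))\<^sup>2"
    by (simp add: power2_eq_square flip: powr_add)
  finally show ?thesis by (rule power2_le_imp_le) simp
qed

lemma det_Ints:
  fixes A :: "'a :: comm_ring_1 mat"
  assumes "\<And>i j. i < dim_row A \<Longrightarrow> j < dim_col A \<Longrightarrow> A $$ (i, j) \<in> \<int>"
  shows "det A \<in> \<int>"
  unfolding det_def using assms
  by (auto intro!: Ints_sum Ints_mult Ints_prod simp: sign_def permutes_in_image)

section \<open>Balanced weights\<close>

text \<open>The real relaxation of a multiplicity function on \<open>T\<close>. Signs are
  unrestricted, so differences of weights are again weights.\<close>

definition balanced_weight :: "nat \<Rightarrow> nat set set \<Rightarrow> (nat set \<Rightarrow> real) \<Rightarrow> real \<Rightarrow> bool" where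
  "balanced_weight N T x t \<longleftrightarrow> (\<forall>i \<in> {1..N}. (\<Sum>S\<in>T. x S * of_bool (i \<in> S)) = t)"

text \<open>Complexity 0 expresses a linear relation, so this is linear independence over the reals
  of the indicator vectors of the members of \<open>T\<close>.\<close>

definition independent_sets :: "nat \<Rightarrow> nat set set \<Rightarrow> bool" where
  "independent_sets N T \<longleftrightarrow> (\<forall>z. balanced_weight N T z 0 \<longrightarrow> (\<forall>S\<in>T. z S = 0))"

definition incidence_mat :: "nat \<Rightarrow> (nat \<Rightarrow> nat set) \<Rightarrow> real mat" where
  "incidence_mat N F = mat N N (\<lambda>(i, j). of_bool (Suc i \<in> F j))"

lemma incidence_mat_carrier [simp]: "incidence_mat N F \<in> carrier_mat N N"
  by (simp add: incidence_mat_def)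

lemma balanced_weight_diff:
  assumes "balanced_weight N T x t" "balanced_weight N T g d"
  shows "balanced_weight N T (\<lambda>S. x S - c * g S) (t - c * d)"
  using assms unfolding balanced_weight_def
  by (simp add: left_diff_distrib sum_subtractf mult.assoc flip: sum_distrib_left)

lemma balanced_weight_mono_neutral:
  assumes "finite T" "T' \<subseteq> T" "\<And>S. S \<in> T - T' \<Longrightarrow> x S = 0"
  shows "balanced_weight N T' x t \<longleftrightarrow> balanced_weight N T x t"
proof -
  have "(\<Sum>S\<in>T'. x S * of_bool (i \<in> S)) = (\<Sum>S\<in>T. x S * of_bool (i \<in> S))" for i
    using assms by (intro sum.mono_neutral_left) auto
  then show ?thesis unfolding balanced_weight_def by simp
qed

section \<open>Integral weights from nonsingular incidence matrices\<close>

text \<open>Collecting coefficients over the fibres of \<open>F\<close>, which may repeat sets,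
  turns a combination of columns into a weight on \<open>T\<close>.\<close>

lemma sum_over_image_eq:
  fixes z :: "nat \<Rightarrow> real"
  assumes "finite T" "\<And>j. j < N \<Longrightarrow> F j \<notin> T \<Longrightarrow> z j = 0"
  shows "(\<Sum>j<N. z j * h (F j)) = (\<Sum>S\<in>T. (\<Sum>j | j < N \<and> F j = S. z j) * h S)"
proof -
  have "(\<Sum>S\<in>T. (\<Sum>j | j < N \<and> F j = S. z j) * h S)
      = (\<Sum>S\<in>T. \<Sum>j\<in>{j \<in> {j. j < N \<and> F j \<in> T}. F j = S}. z j * h (F j))"
    by (auto simp: sum_distrib_right intro!: sum.cong)
  also have "\<dots> = (\<Sum>j | j < N \<and> F j \<in> T. z j * h (F j))"
    using assms(1) by (intro sum.group) auto
  also have "\<dots> = (\<Sum>j<N. z j * h (F j))"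
    using assms(2) by (intro sum.mono_neutral_left) auto
  finally show ?thesis by simp
qed

text \<open>Columns of the identity matrix are exchanged for members of \<open>T\<close> as long as possible.\<close>

lemma independent_sets_extend:
  assumes T: "finite T" and ind: "independent_sets N T"
  obtains F where "det (incidence_mat N F) \<noteq> 0" "T \<subseteq> F ` {..<N}"
proof -
  define P where "P = (\<lambda>F. det (incidence_mat N F) \<noteq> 0)"
  define \<phi> where "\<phi> = (\<lambda>F. card (T \<inter> F ` {..<N}))"
  have "incidence_mat N (\<lambda>j. {Suc j}) = 1\<^sub>m N"
    by (intro eq_matI) (auto simp: incidence_mat_def)
  then have "P (\<lambda>j. {Suc j})" unfolding P_def by simp
  moreover have "\<phi> F \<le> card T" for F
    unfolding \<phi>_def using T by (intro card_mono) auto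
  ultimately obtain F where F: "P F" and max: "\<And>G. P G \<Longrightarrow> \<phi> G \<le> \<phi> F"
    using ex_has_greatest_nat[of P "\<lambda>j. {Suc j}" \<phi> "Suc (card T)"] by (metis less_Suc_eq_le)
  have "S \<in> F ` {..<N}" if S: "S \<in> T" for S
  proof (rule ccontr)
    assume nin: "S \<notin> F ` {..<N}"
    define B where "B = incidence_mat N F"
    have B: "B \<in> carrier_mat N N" unfolding B_def by simp
    have detB: "det B \<noteq> 0" using F unfolding P_def B_def .
    define s where "s = vec N (\<lambda>i. of_bool (Suc i \<in> S) :: real)"
    \<comment> \<open>The inverse of \<open>B\<close>, written with the adjugate, applied to
      \<open>s\<close>: the coordinates of the missing set \<open>S\<close> in the columns of
      \<open>B\<close>.\<close>
    define z where "z = (1 / det B) \<cdot>\<^sub>v (adj_mat B *\<^sub>v s)"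
    have s: "s \<in> carrier_vec N" unfolding s_def by simp
    have z: "z \<in> carrier_vec N" using adj_mat(1)[OF B] s unfolding z_def by auto
    have "B *\<^sub>v z = (1 / det B) \<cdot>\<^sub>v (B *\<^sub>v (adj_mat B *\<^sub>v s))"
      unfolding z_def using B adj_mat(1)[OF B] s by (intro mult_mat_vec) auto
    also have "B *\<^sub>v (adj_mat B *\<^sub>v s) = (B * adj_mat B) *\<^sub>v s"
      using B adj_mat(1)[OF B] s by (intro assoc_mult_mat_vec[symmetric]) auto
    also have "\<dots> = det B \<cdot>\<^sub>v s" unfolding adj_mat(2)[OF B] using s by auto
    finally have Bz: "B *\<^sub>v z = s" using detB by (simp add: smult_smult_assoc)
    show False
    proof (cases "\<exists>j<N. F j \<notin> T \<and> z $ j \<noteq> 0")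
      case True
      then obtain j where j: "j < N" "F j \<notin> T" "z $ j \<noteq> 0" by blast
      define G where "G = F(j := S)"
      \<comment> \<open>By Cramer's rule the exchange multiplies the determinant by
        \<open>z $ j\<close>, which is nonzero. The column given up is not in \<open>T\<close>, so
        the count grows, against maximality.\<close>
      have "incidence_mat N G = replace_col B s j"
        by (rule eq_matI) (auto simp: incidence_mat_def replace_col_def B_def G_def s_def)
      then have "P G"
        using cramer_lemma_mat[OF B z j(1)] j detB unfolding P_def Bz by simp
      moreover have "T \<inter> F ` {..<N} \<subset> T \<inter> G ` {..<N}"
      proof
        show "T \<inter> F ` {..<N} \<subseteq> T \<inter> G ` {..<N}"
        proof
          fix R assume R: "R \<in> T \<inter> F ` {..<N}"
          then obtain l where "l < N" "R = F l" by auto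
          then show "R \<in> T \<inter> G ` {..<N}" using R j(2) unfolding G_def by (auto intro!: image_eqI[of _ _ l])
        qed
        have "S \<in> T \<inter> G ` {..<N}" using S j(1) unfolding G_def by auto
        then show "T \<inter> F ` {..<N} \<noteq> T \<inter> G ` {..<N}" using nin by blast
      qed
      then have "\<phi> F < \<phi> G" unfolding \<phi>_def using T by (intro psubset_card_mono) auto
      ultimately show False using max[of G] by simp
    next
      case False
      \<comment> \<open>Only columns lying in \<open>T\<close> have nonzero coefficients, so
        \<open>w\<close> is a linear relation on \<open>T\<close>. Since \<open>S\<close> is not a
        column, its fibre sum is empty and its coefficient is -1.\<close>
      define w where "w = (\<lambda>R. (\<Sum>j | j < N \<and> F j = R. z $ j) - of_bool (R = S))"
      have "balanced_weight N T w 0"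
        unfolding balanced_weight_def
      proof
        fix i assume i: "i \<in> {1..N}"
        then have i': "i - 1 < N" "Suc (i - 1) = i" by auto
        have "(\<Sum>j<N. z $ j * of_bool (i \<in> F j)) = (B *\<^sub>v z) $ (i - 1)"
          using i' z unfolding B_def incidence_mat_def scalar_prod_def
          by (auto simp: scalar_prod_def lessThan_atLeast0 intro!: sum.cong)
        also have "\<dots> = of_bool (i \<in> S)" unfolding Bz s_def using i' by simp
        finally have "(\<Sum>j<N. z $ j * of_bool (i \<in> F j)) = of_bool (i \<in> S)" .
        then have *: "(\<Sum>R\<in>T. (\<Sum>j | j < N \<and> F j = R. z $ j) * of_bool (i \<in> R)) = of_bool (i \<in> S)"
          by (subst sum_over_image_eq[OF T, of N F "\<lambda>j. z $ j", symmetric]) (use False in auto)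
        have "(\<Sum>R\<in>T. of_bool (R = S) * of_bool (i \<in> R) :: real)
            = (\<Sum>R\<in>T. if R = S then of_bool (i \<in> S) else 0)"
          by (intro sum.cong) auto
        then show "(\<Sum>R\<in>T. w R * of_bool (i \<in> R)) = 0"
          unfolding w_def left_diff_distrib sum_subtractf * using S T by simp
      qed
      moreover have "(\<Sum>j | j < N \<and> F j = S. z $ j) = 0" using nin by (intro sum.neutral) auto
      then have "w S = - 1" unfolding w_def by simp
      ultimately show False using ind S unfolding independent_sets_def by force
    qed
  qed
  then show ?thesis using that F unfolding P_def by blast
qed

text \<open>Cramer's rule: after scaling to complexity \<open>d = \<bar>det B\<bar>\<close>, where the columns of \<open>B\<close> include the
  members of \<open>T\<close>, the weight is integral.\<close>

lemma independent_weight_integral: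
  assumes T: "finite T" and ind: "independent_sets N T"
    and bal: "balanced_weight N T y 1" and nonneg: "\<And>S. S \<in> T \<Longrightarrow> y S \<ge> 0"
  obtains d :: nat where "d > 0" "2 ^ N * real d \<le> (real N + 1) powr ((real N + 1) / 2)"
    "\<And>S. S \<in> T \<Longrightarrow> real d * y S \<in> \<nat>"
proof -
  obtain F where det0: "det (incidence_mat N F) \<noteq> 0" and TF: "T \<subseteq> F ` {..<N}"
    using independent_sets_extend[OF T ind] by blast
  define B where "B = incidence_mat N F"
  have B: "B \<in> carrier_mat N N" unfolding B_def by simp
  have detB: "det B \<noteq> 0" using det0 unfolding B_def .
  \<comment> \<open>Equal columns would make the determinant vanish. Injectivity lets sums over
    columns be read as sums over sets.\<close>
  have inj: "inj_on F {..<N}"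
  proof (rule inj_onI)
    fix i j assume ij: "i \<in> {..<N}" "j \<in> {..<N}" "F i = F j"
    then have "col B i = col B j"
      unfolding B_def incidence_mat_def by (intro eq_vecI) auto
    then show "i = j" using det_identical_columns[OF B, of i j] ij detB by auto
  qed
  define z where "z = vec N (\<lambda>j. if F j \<in> T then y (F j) else 0)"
  have z: "z \<in> carrier_vec N" unfolding z_def by simp
  have Bz: "B *\<^sub>v z = vec N (\<lambda>_. 1)"
  proof (rule eq_vecI)
    fix i assume "i < dim_vec (vec N (\<lambda>_. 1 :: real))"
    then have i: "i < N" by simp
    have "(B *\<^sub>v z) $ i = (\<Sum>j<N. (if F j \<in> T then y (F j) else 0) * of_bool (Suc i \<in> F j))"
      using i unfolding B_def z_def incidence_mat_def
      by (auto simp: scalar_prod_def lessThan_atLeast0 intro!: sum.cong)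
    also have "\<dots> = (\<Sum>S\<in>F ` {..<N}. (if S \<in> T then y S else 0) * of_bool (Suc i \<in> S))"
      by (simp add: sum.reindex[OF inj])
    also have "\<dots> = (\<Sum>S\<in>T. y S * of_bool (Suc i \<in> S))"
      using TF by (intro sum.mono_neutral_cong_right) auto
    also have "\<dots> = 1" using bal i unfolding balanced_weight_def by simp
    finally show "(B *\<^sub>v z) $ i = vec N (\<lambda>_. 1) $ i" using i by simp
  qed (use B in simp)
  have "det B \<in> \<int>" by (rule det_Ints) (auto simp: B_def incidence_mat_def)
  then obtain b where b: "det B = of_int b" by (auto elim: Ints_cases)
  define d where "d = nat \<bar>b\<bar>"
  have d: "real d = \<bar>det B\<bar>" unfolding d_def b by simp
  have "real d * y S \<in> \<nat>" if S: "S \<in> T" for S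
  proof -
    obtain j where j: "j < N" "S = F j" using TF S by auto
    \<comment> \<open>Since \<open>B\<close> sends \<open>z\<close> to the all-ones vector, this is
      the determinant of \<open>B\<close> with column \<open>j\<close> replaced by ones.\<close>
    have "z $ j * det B \<in> \<int>"
      unfolding cramer_lemma_mat[OF B z j(1), symmetric] Bz
      by (rule det_Ints) (auto simp: replace_col_def B_def incidence_mat_def)
    then have "y S * det B \<in> \<int>" using j S unfolding z_def by simp
    then have "y S * real d \<in> \<int>" unfolding d by (simp add: abs_if)
    moreover have "y S * real d \<ge> 0" using nonneg[OF S] by simp
    ultimately show ?thesis by (simp add: Nats_altdef2 mult.commute)
  qed
  moreover have "d > 0" using detB d by (cases d) auto
  moreover have "2 ^ N * real d \<le> (real N + 1) powr ((real N + 1) / 2)"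
    unfolding d by (rule det_zero_one_matrix_le[OF B]) (auto simp: B_def incidence_mat_def)
  ultimately show ?thesis using that by blast
qed

section \<open>Caratheodory reduction and peeling\<close>

text \<open>The minimum-ratio rule of the simplex method: \<open>c\<close> is the least quotient
  \<open>x S / g S\<close> with \<open>g S > 0\<close>, so \<open>c * g\<close> stays below
  \<open>x\<close> and touches it at \<open>S\<^sub>0\<close>.\<close>

lemma exists_max_step:
  fixes x g :: "'a \<Rightarrow> real"
  assumes T: "finite T" and x: "\<And>S. S \<in> T \<Longrightarrow> x S \<ge> 0" and g: "\<exists>S\<in>T. g S > 0"
  obtains c S\<^sub>0 where "c \<ge> 0" "S\<^sub>0 \<in> T" "g S\<^sub>0 > 0" "x S\<^sub>0 = c * g S\<^sub>0"
    "\<And>S. S \<in> T \<Longrightarrow> c * g S \<le> x S"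
proof -
  define U where "U = {S \<in> T. g S > 0}"
  have U: "finite U" "U \<noteq> {}" using T g unfolding U_def by auto
  define S\<^sub>0 where "S\<^sub>0 = arg_min_on (\<lambda>S. x S / g S) U"
  have S0: "S\<^sub>0 \<in> U" unfolding S\<^sub>0_def using U by (rule arg_min_if_finite)
  have min: "x S\<^sub>0 / g S\<^sub>0 \<le> x S / g S" if "S \<in> U" for S
    unfolding S\<^sub>0_def using U that by (intro arg_min_least) auto
  have c: "x S\<^sub>0 / g S\<^sub>0 \<ge> 0" using S0 x unfolding U_def by auto
  have "x S\<^sub>0 / g S\<^sub>0 * g S \<le> x S" if "S \<in> T" for S
  proof (cases "S \<in> U")
    case True
    then show ?thesis using min[OF True] unfolding U_def by (simp add: pos_le_divide_eq)
  next
    case False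
    then have "x S\<^sub>0 / g S\<^sub>0 * g S \<le> 0" using c that by (intro mult_nonneg_nonpos) (auto simp: U_def)
    then show ?thesis using x[OF that] by linarith
  qed
  then show ?thesis using that[of "x S\<^sub>0 / g S\<^sub>0" S\<^sub>0] c S0 unfolding U_def by auto
qed

text \<open>Moving along a linear relation changes no total; going on until some value reaches 0
  shrinks the support.\<close>

lemma exists_independent_weight:
  assumes T: "finite T" and bal: "balanced_weight N T x 1" and x: "\<And>S. S \<in> T \<Longrightarrow> x S > 0"
  shows "\<exists>T' y. T' \<subseteq> T \<and> independent_sets N T' \<and> balanced_weight N T' y 1 \<and> (\<forall>S\<in>T'. y S > 0)"
  using T bal x
proof (induction T arbitrary: x rule: finite_psubset_induct)
  case (psubset T)
  show ?case
  proof (cases "independent_sets N T")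
    case True
    then show ?thesis using psubset.prems by blast
  next
    case False
    then obtain z' S where z': "balanced_weight N T z' 0" "S \<in> T" "z' S \<noteq> 0"
      unfolding independent_sets_def by blast
    \<comment> \<open>Either the relation or its negative is positive at \<open>S\<close>, as the
      ratio rule requires.\<close>
    obtain z where z: "balanced_weight N T z 0" "z S > 0"
    proof (cases "z' S > 0")
      case True
      then show ?thesis using that z' by blast
    next
      case False
      have "balanced_weight N T (\<lambda>S. 0) 0" unfolding balanced_weight_def by simp
      from balanced_weight_diff[OF this z'(1), of 1]
      show ?thesis using that[of "\<lambda>S. - z' S"] z'(3) False by simp
    qed
    obtain c S0 where c: "S0 \<in> T" "x S0 = c * z S0" "\<And>S. S \<in> T \<Longrightarrow> c * z S \<le> x S"
      using exists_max_step[of T x z] psubset.prems(2) \<open>finite T\<close> z(2) \<open>S \<in> T\<close>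
      by (metis less_imp_le)
    define w where "w = (\<lambda>S. x S - c * z S)"
    define T' where "T' = {S \<in> T. w S > 0}"
    have w: "w S \<ge> 0" if "S \<in> T" for S using c(3)[OF that] unfolding w_def by simp
    have "S0 \<notin> T'" using c(2) unfolding T'_def w_def by simp
    then have "T' \<subset> T" using c(1) unfolding T'_def by blast
    moreover have "balanced_weight N T w 1"
      using balanced_weight_diff[OF psubset.prems(1) z(1), of c] unfolding w_def by simp
    then have "balanced_weight N T' w 1"
      using w \<open>finite T\<close>
      by (subst balanced_weight_mono_neutral[of T T']) (force simp: T'_def)+
    ultimately show ?thesis
      using psubset.IH[of T' w] unfolding T'_def by blast
  qed
qed

text \<open>After scaling to complexity 1 and passing to independent support, multiplication by a
  determinant \<open>d\<close> clears all denominators.\<close>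

lemma exists_small_integral_weight:
  assumes N: "N \<ge> 1" and T: "finite T" and t: "t > 0" and bal: "balanced_weight N T x t"
    and x: "\<And>S. S \<in> T \<Longrightarrow> x S > 0"
  obtains g :: "nat set \<Rightarrow> nat" and d :: nat where "d > 0"
    "2 ^ N * real d \<le> (real N + 1) powr ((real N + 1) / 2)"
    "balanced_weight N T (\<lambda>S. real (g S)) (real d)" "\<And>S. S \<notin> T \<Longrightarrow> g S = 0" "\<exists>S\<in>T. g S > 0"
proof -
  have "balanced_weight N T (\<lambda>S. x S / t) 1"
    using bal t unfolding balanced_weight_def by (simp flip: sum_divide_distrib)
  then obtain T' y where T': "T' \<subseteq> T" "independent_sets N T'" "balanced_weight N T' y 1"
    and y: "\<And>S. S \<in> T' \<Longrightarrow> y S > 0"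
    using exists_independent_weight[OF T, of N "\<lambda>S. x S / t"] x t by auto
  have fT': "finite T'" using T T'(1) finite_subset by blast
  obtain d :: nat where d: "d > 0" "2 ^ N * real d \<le> (real N + 1) powr ((real N + 1) / 2)"
    and dy: "\<And>S. S \<in> T' \<Longrightarrow> real d * y S \<in> \<nat>"
    using independent_weight_integral[OF fT' T'(2,3)] y by (metis less_imp_le)
  \<comment> \<open>The floor only changes the type: on \<open>T'\<close> these products are natural
    numbers.\<close>
  define g where "g = (\<lambda>S. if S \<in> T' then nat \<lfloor>real d * y S\<rfloor> else 0)"
  have g: "real (g S) = real d * y S" if "S \<in> T'" for S
    using dy[OF that] that unfolding g_def by (auto elim!: Nats_cases)
  have "balanced_weight N T' (\<lambda>S. real (g S)) (real d)"
    using T'(3) unfolding balanced_weight_def by (simp add: g mult.assoc flip: sum_distrib_left)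
  then have bg: "balanced_weight N T (\<lambda>S. real (g S)) (real d)"
    by (subst (asm) balanced_weight_mono_neutral[OF T T'(1)]) (auto simp: g_def)
  have "\<exists>S\<in>T. g S > 0"
  proof (rule ccontr)
    assume "\<not> ?thesis"
    \<comment> \<open>Element 1 lies in the ground set because \<open>N \<ge> 1\<close>; its total
      would be 0 instead of \<open>d\<close>.\<close>
    then have "(\<Sum>S\<in>T. real (g S) * of_bool (1 \<in> S)) = 0" by (intro sum.neutral) auto
    then show False using bg N d(1) unfolding balanced_weight_def by auto
  qed
  moreover have "g S = 0" if "S \<notin> T" for S using T'(1) that unfolding g_def by auto
  ultimately show ?thesis using that[OF d bg] by blast
qed

text \<open>Take the largest multiple \<open>c * g\<close> of a small integral weight below
  \<open>x\<close>. If \<open>c \<ge> 1\<close>, then \<open>g\<close> itself fits. Otherwise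
  subtracting it removes a set from the support at a cost of at most \<open>D\<close>, so
  \<open>large\<close> persists; with empty support it would contradict balance.\<close>

lemma peel_balanced_weight:
  fixes D :: real
  assumes N: "N \<ge> 1" and D: "2 ^ N * D = (real N + 1) powr ((real N + 1) / 2)"
    and T: "finite T" and bal: "balanced_weight N T x t" and x: "\<And>S. S \<in> T \<Longrightarrow> x S > 0"
    and large: "real (card T) * D < t"
  shows "\<exists>(g :: nat set \<Rightarrow> nat) d :: nat. d > 0 \<and> real d \<le> D \<and>
    balanced_weight N T (\<lambda>S. real (g S)) (real d) \<and> (\<forall>S. S \<notin> T \<longrightarrow> g S = 0) \<and> (\<forall>S\<in>T. real (g S) \<le> x S)"
  using T bal x large
proof (induction T arbitrary: x t rule: finite_psubset_induct)
  case (psubset T)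
  have "2 ^ N * D > 0" unfolding D by simp
  then have D0: "D > 0" by (simp add: zero_less_mult_iff)
  have t: "t > 0" using psubset.prems(3) D0 by (smt (verit) mult_nonneg_nonneg of_nat_0_le_iff)
  obtain g :: "nat set \<Rightarrow> nat" and d :: nat where d: "d > 0"
      "2 ^ N * real d \<le> (real N + 1) powr ((real N + 1) / 2)"
    and g: "balanced_weight N T (\<lambda>S. real (g S)) (real d)" "\<And>S. S \<notin> T \<Longrightarrow> g S = 0"
      "\<exists>S\<in>T. g S > 0"
    using exists_small_integral_weight[OF N \<open>finite T\<close> t psubset.prems(1,2)] by metis
  have dD: "real d \<le> D" using d(2) unfolding D[symmetric] by simp
  obtain c S0 where c: "c \<ge> 0" "S0 \<in> T" "x S0 = c * real (g S0)"
    "\<And>S. S \<in> T \<Longrightarrow> c * real (g S) \<le> x S"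
    using exists_max_step[of T x "\<lambda>S. real (g S)"] psubset.prems(2) \<open>finite T\<close> g(3)
    by (metis less_imp_le of_nat_0_less_iff)
  show ?case
  proof (cases "c \<ge> 1")
    case True
    have "real (g S) \<le> x S" if "S \<in> T" for S
      using c(4)[OF that] mult_right_mono[OF True, of "real (g S)"] by simp
    then show ?thesis using d(1) dD g by blast
  next
    case False
    define w where "w = (\<lambda>S. x S - c * real (g S))"
    define T' where "T' = {S \<in> T. w S > 0}"
    have w: "w S \<ge> 0" if "S \<in> T" for S using c(4)[OF that] unfolding w_def by simp
    have "S0 \<notin> T'" using c(3) unfolding T'_def w_def by simp
    then have sub: "T' \<subset> T" using c(2) unfolding T'_def by blast
    have bw: "balanced_weight N T w (t - c * real d)"
      using balanced_weight_diff[OF psubset.prems(1) g(1), of c] unfolding w_def .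
    have bw': "balanced_weight N T' w (t - c * real d)"
      using bw w \<open>finite T\<close>
      by (subst balanced_weight_mono_neutral[of T T']) (force simp: T'_def)+
    have "Suc (card T') \<le> card T"
      using psubset_card_mono[OF \<open>finite T\<close> sub] by simp
    then have "real (card T') + 1 \<le> real (card T)" by linarith
    \<comment> \<open>Losing one set from the support releases a full \<open>D\<close>, which pays
      for the complexity \<open>c * d\<close> removed.\<close>
    then have "(real (card T') + 1) * D \<le> real (card T) * D" using D0 by simp
    moreover have "c * real d \<le> D"
      using mult_mono[of c 1 "real d" D] False c(1) dD by simp
    ultimately have large: "real (card T') * D < t - c * real d"
      using psubset.prems(3) by (simp add: distrib_right)
    obtain g' :: "nat set \<Rightarrow> nat" and d' :: nat where g': "d' > 0" "real d' \<le> D"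
      "balanced_weight N T' (\<lambda>S. real (g' S)) (real d')" "\<And>S. S \<notin> T' \<Longrightarrow> g' S = 0"
      "\<And>S. S \<in> T' \<Longrightarrow> real (g' S) \<le> w S"
      using psubset.IH[OF sub bw' _ large] unfolding T'_def by blast
    have "balanced_weight N T (\<lambda>S. real (g' S)) (real d')"
      using g'(3) sub \<open>finite T\<close> g'(4) by (subst (asm) balanced_weight_mono_neutral[of T T']) auto
    moreover have "g' S = 0" if "S \<notin> T" for S using g'(4) that sub by blast
    moreover have "real (g' S) \<le> x S" if "S \<in> T" for S
    proof (cases "S \<in> T'")
      case True
      have "c * real (g S) \<ge> 0" using c(1) by simp
      then show ?thesis using g'(5)[OF True] unfolding w_def by linarith
    next
      case False
      then show ?thesis using g'(4) psubset.prems(2)[OF that] by simp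
    qed
    ultimately show ?thesis using g'(1,2) by blast
  qed
qed

section \<open>Irreducible multisets\<close>

text \<open>The passage between multisets and weights. \<open>T\<close> may exceed the support, so
  that a sub-multiset can be weighed over the support of the whole.\<close>

lemma balanced_weight_count_iff:
  assumes "finite T" "set_mset M \<subseteq> T"
  shows "balanced_weight N T (\<lambda>S. real (count M S)) (real m)
    \<longleftrightarrow> (\<forall>i \<in> {1..N}. size {#S \<in># M. i \<in> S#} = m)"
proof -
  have "(\<Sum>S\<in>T. real (count M S) * of_bool (i \<in> S)) = real (size {#S \<in># M. i \<in> S#})" for i
  proof -
    have "size {#S \<in># M. i \<in> S#} = (\<Sum>S\<in>T. count {#S \<in># M. i \<in> S#} S)"
      unfolding size_multiset_overloaded_eq using assms
      by (intro sum.mono_neutral_left) (auto simp: count_eq_zero_iff)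
    then show ?thesis by (auto intro!: sum.cong)
  qed
  then show ?thesis unfolding balanced_weight_def by simp
qed

theorem theorem4p7:
  fixes N m :: nat and M :: "nat set multiset"
  assumes "N \<ge> 1"
    and "Z_irreducible N M"
    and "balanced_with_complexity N M m"
  shows "real m \<le> (real N + 1) powr ((real N + 1) / 2)"
proof (rule ccontr)
  assume neg: "\<not> ?thesis"
  \<comment> \<open>The bound for determinants of 0/1 matrices of size \<open>N\<close>; the factor
    \<open>2 ^ N\<close> divided out here returns as the number of subsets of the ground
    set.\<close>
  define D where "D = (real N + 1) powr ((real N + 1) / 2) / 2 ^ N"
  have D: "2 ^ N * D = (real N + 1) powr ((real N + 1) / 2)" unfolding D_def by simp
  have D0: "D \<ge> 0" unfolding D_def by simp
  have sub: "set_mset M \<subseteq> Pow {1..N}"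
    using assms(3) unfolding balanced_with_complexity_def by auto
  have bal: "balanced_weight N (set_mset M) (\<lambda>S. real (count M S)) (real m)"
    using assms(3) unfolding balanced_with_complexity_def by (subst balanced_weight_count_iff) auto
  have "card (set_mset M) \<le> 2 ^ N"
    using card_mono[OF _ sub] by (simp add: card_Pow)
  then have "real (card (set_mset M)) \<le> 2 ^ N"
    by (metis of_nat_le_iff of_nat_numeral of_nat_power)
  then have "real (card (set_mset M)) * D \<le> 2 ^ N * D" using D0 by (rule mult_right_mono)
  then have large: "real (card (set_mset M)) * D < real m" using neg D by linarith
  obtain g :: "nat set \<Rightarrow> nat" and d :: nat where d: "d > 0" "real d \<le> D"
    and bg: "balanced_weight N (set_mset M) (\<lambda>S. real (g S)) (real d)"
    and g0: "\<And>S. S \<notin> set_mset M \<Longrightarrow> g S = 0" and gle: "\<And>S. S \<in> set_mset M \<Longrightarrow> g S \<le> count M S"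
    using peel_balanced_weight[OF assms(1) D _ bal _ large] by auto
  define M' where "M' = Abs_multiset g"
  have "{S. 0 < g S} \<subseteq> set_mset M" using g0 by force
  \<comment> \<open>\<open>Abs_multiset\<close> is faithful on functions of finite support, and
    \<open>g\<close> vanishes off the support of \<open>M\<close>.\<close>
  then have count: "count M' = g"
    unfolding M'_def by (intro count_Abs_multiset) (auto intro: finite_subset)
  have le: "M' \<subseteq># M"
    unfolding subseteq_mset_def count using g0 gle by (metis le0)
  then have sub': "set_mset M' \<subseteq> set_mset M" by (rule set_mset_mono)
  have "\<forall>i \<in> {1..N}. size {#S \<in># M'. i \<in> S#} = d"
    using bg sub' by (subst (asm) count[symmetric], subst (asm) balanced_weight_count_iff) auto
  then have M'bal: "balanced_with_complexity N M' d"
    using sub sub' unfolding balanced_with_complexity_def by auto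
  then have "M' \<noteq> {#}" using d(1) assms(1) unfolding balanced_with_complexity_def by auto
  \<comment> \<open>Irreducibility leaves only the whole multiset, so \<open>m\<close> equals
    \<open>d\<close> and is at most \<open>D\<close>, contrary to the assumed size of
    \<open>m\<close>.\<close>
  then have "M' = M"
    using assms(2) le M'bal unfolding Z_irreducible_def balanced_def
    by (metis subset_mset.le_neq_trans)
  then have "m = d"
    using M'bal assms(1,3) unfolding balanced_with_complexity_def by auto
  moreover have "D \<le> 2 ^ N * D" using mult_right_mono[of 1 "2 ^ N" D] D0 by simp
  ultimately show False using neg d(2) D by linarith
qed

end
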